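(* Let $R$ be a commutative ring with identity, let $A=\{f\in R[X] : f(0)=1\}$, and let $R[X]_A$ be the Anderson ring of $R$. Then the following hold. (1) There is a one-to-one correspondence between the minimal prime ideals of $R$ and the minimal prime ideals of $R[X]_A$. In fact, every minimal prime ideal of $R[X]_A$ is of the form $PR[X]_A$ for some minimal prime ideal $P$ of $R$. (2) There is a one-to-one correspondence between the maximal ideals of $R$ and the maximal ideals of $R[X]_A$. In fact, $\mathrm{Max}(R[X]_A)=\{(M+XR[X])_A : M\in \mathrm{Max}(R)\}$.
   Context: $R[X]$ is the polynomial ring in one variable over $R$; $f(0)$ is the constant term of $f$. The set $A$ is multiplicative, and the Anderson ring $R[X]_A$ is the localization of $R[X]$ at $A$. For an ideal $\mathfrak{a}$ of $R[X]$, $\mathfrak{a}_A=\mathfrak{a}R[X]_A$ denotes its extension to $R[X]_A$; for an ideal $I$ of $R$, $IR[X]_A$ is its extension. $\mathrm{Max}(\cdot)$ is the set of maximal ideals. The correspondences are $P\mapsto PR[X]_A$ and $M\mapsto (M+XR[X])_A$. *)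

theory Defs
  imports "HOL-Algebra.UnivPoly"
begin

section \<open>Localization of a commutative ring at a multiplicative set\<close>

definition loc_rel :: "('a, 'm) ring_scheme \<Rightarrow> 'a set \<Rightarrow> (('a \<times> 'a) \<times> ('a \<times> 'a)) set"
  where "loc_rel R S = {((a, s), (b, t)). a \<in> carrier R \<and> s \<in> S \<and> b \<in> carrier R \<and> t \<in> S \<and>
    (\<exists>u\<in>S. u \<otimes>\<^bsub>R\<^esub> (a \<otimes>\<^bsub>R\<^esub> t \<ominus>\<^bsub>R\<^esub> b \<otimes>\<^bsub>R\<^esub> s) = \<zero>\<^bsub>R\<^esub>)}"

definition fraction :: "('a, 'm) ring_scheme \<Rightarrow> 'a set \<Rightarrow> 'a \<Rightarrow> 'a \<Rightarrow> ('a \<times> 'a) set"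
  where "fraction R S a s = loc_rel R S `` {(a, s)}"

text \<open>The operations are given as unions over representatives; the lemmas \<open>loc_mult_fraction\<close> and
  \<open>loc_add_fraction\<close> below show that they are well defined when \<open>S\<close> is a submonoid.\<close>

definition localization :: "('a, 'm) ring_scheme \<Rightarrow> 'a set \<Rightarrow> ('a \<times> 'a) set ring"
  where "localization R S = \<lparr>
    carrier = (carrier R \<times> S) // loc_rel R S,
    mult = (\<lambda>U V. \<Union>(a, s)\<in>U. \<Union>(b, t)\<in>V. fraction R S (a \<otimes>\<^bsub>R\<^esub> b) (s \<otimes>\<^bsub>R\<^esub> t)),
    one = fraction R S \<one>\<^bsub>R\<^esub> \<one>\<^bsub>R\<^esub>,
    zero = fraction R S \<zero>\<^bsub>R\<^esub> \<one>\<^bsub>R\<^esub>,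
    add = (\<lambda>U V. \<Union>(a, s)\<in>U. \<Union>(b, t)\<in>V.
      fraction R S (a \<otimes>\<^bsub>R\<^esub> t \<oplus>\<^bsub>R\<^esub> b \<otimes>\<^bsub>R\<^esub> s) (s \<otimes>\<^bsub>R\<^esub> t))\<rparr>"

definition loc_map :: "('a, 'm) ring_scheme \<Rightarrow> 'a set \<Rightarrow> 'a \<Rightarrow> ('a \<times> 'a) set"
  where "loc_map R S a = fraction R S a \<one>\<^bsub>R\<^esub>"

definition ideal_extension :: "('b, 'n) ring_scheme \<Rightarrow> ('a \<Rightarrow> 'b) \<Rightarrow> 'a set \<Rightarrow> 'b set"
  where "ideal_extension T h I = Idl\<^bsub>T\<^esub> (h ` I)"


section \<open>The Anderson ring\<close>

definition anderson_set :: "('a, 'm) ring_scheme \<Rightarrow> (nat \<Rightarrow> 'a) set"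
  where "anderson_set R = {f \<in> carrier (UP R). coeff (UP R) f 0 = \<one>\<^bsub>R\<^esub>}"

definition anderson_ring :: "('a, 'm) ring_scheme \<Rightarrow> ((nat \<Rightarrow> 'a) \<times> (nat \<Rightarrow> 'a)) set ring"
  where "anderson_ring R = localization (UP R) (anderson_set R)"

definition const_poly :: "('a, 'm) ring_scheme \<Rightarrow> 'a \<Rightarrow> nat \<Rightarrow> 'a"
  where "const_poly R a = monom (UP R) a 0"

definition poly_to_anderson ::
    "('a, 'm) ring_scheme \<Rightarrow> (nat \<Rightarrow> 'a) \<Rightarrow> ((nat \<Rightarrow> 'a) \<times> (nat \<Rightarrow> 'a)) set"
  where "poly_to_anderson R = loc_map (UP R) (anderson_set R)"

text \<open>\<open>poly_ext R \<aa>\<close> is the extension of the ideal \<open>\<aa>\<close> of \<open>R[X]\<close>, and \<open>base_ext R I\<close> that of the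
  ideal \<open>I\<close> of \<open>R\<close>, to the Anderson ring.\<close>

definition poly_ext ::
    "('a, 'm) ring_scheme \<Rightarrow> (nat \<Rightarrow> 'a) set \<Rightarrow> ((nat \<Rightarrow> 'a) \<times> (nat \<Rightarrow> 'a)) set set"
  where "poly_ext R = ideal_extension (anderson_ring R) (poly_to_anderson R)"

definition base_ext ::
    "('a, 'm) ring_scheme \<Rightarrow> 'a set \<Rightarrow> ((nat \<Rightarrow> 'a) \<times> (nat \<Rightarrow> 'a)) set set"
  where "base_ext R = ideal_extension (anderson_ring R) (poly_to_anderson R \<circ> const_poly R)"

text \<open>\<open>M + XR[X] = {m + X g | m \<in> M, g \<in> R[X]}\<close>\<close>

definition plus_X_ideal :: "('a, 'm) ring_scheme \<Rightarrow> 'a set \<Rightarrow> (nat \<Rightarrow> 'a) set"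
  where "plus_X_ideal R M = const_poly R ` M <+>\<^bsub>UP R\<^esub> (PIdl\<^bsub>UP R\<^esub> (monom (UP R) \<one>\<^bsub>R\<^esub> 1))"


section \<open>Minimal primes and maximal ideals\<close>

definition min_primes :: "('a, 'm) ring_scheme \<Rightarrow> 'a set set"
  where "min_primes R = {P. primeideal P R \<and> (\<forall>Q. primeideal Q R \<and> Q \<subseteq> P \<longrightarrow> Q = P)}"

definition max_ideals :: "('a, 'm) ring_scheme \<Rightarrow> 'a set set"
  where "max_ideals R = {M. maximalideal M R}"


section \<open>Well-definedness\<close>

locale cring_mult_set = cring R + submonoid S R for R (structure) and S
begin

lemma S_carr [simp]: "s \<in> S \<Longrightarrow> s \<in> carrier R"
  using subset by auto

lemma loc_rel_iff:
  "((a, s), (b, t)) \<in> loc_rel R S \<longleftrightarrow> a \<in> carrier R \<and> s \<in> S \<and> b \<in> carrier R \<and> t \<in> S \<and>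
    (\<exists>u\<in>S. u \<otimes> (a \<otimes> t) = u \<otimes> (b \<otimes> s))"
proof -
  have "u \<otimes> (a \<otimes> t \<ominus> b \<otimes> s) = \<zero> \<longleftrightarrow> u \<otimes> (a \<otimes> t) = u \<otimes> (b \<otimes> s)"
    if "a \<in> carrier R" "s \<in> S" "b \<in> carrier R" "t \<in> S" "u \<in> S" for u
  proof -
    have "u \<otimes> (a \<otimes> t \<ominus> b \<otimes> s) = u \<otimes> (a \<otimes> t) \<ominus> u \<otimes> (b \<otimes> s)"
      using that by (simp add: a_minus_def r_distr r_minus)
    moreover have "x \<ominus> y = \<zero> \<longleftrightarrow> x = y" if "x \<in> carrier R" "y \<in> carrier R" for x y
      using that by (metis a_minus_def add.inv_solve_right' l_zero zero_closed)
    ultimately show ?thesis using that by simp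
  qed
  then show ?thesis unfolding loc_rel_def by auto
qed

lemma equiv_loc_rel: "equiv (carrier R \<times> S) (loc_rel R S)"
proof (rule equivI)
  show "loc_rel R S \<subseteq> (carrier R \<times> S) \<times> (carrier R \<times> S)"
    by (auto simp: loc_rel_def)
  show "refl_on (carrier R \<times> S) (loc_rel R S)"
    by (auto simp: refl_on_def loc_rel_iff intro: bexI[of _ \<one>])
  show "sym (loc_rel R S)"
    by (auto simp: sym_def loc_rel_iff intro: sym)
  show "trans (loc_rel R S)"
  proof (rule transI, clarify)
    fix a s b t c v
    assume "((a, s), (b, t)) \<in> loc_rel R S" "((b, t), (c, v)) \<in> loc_rel R S"
    then obtain u w where c: "a \<in> carrier R" "s \<in> S" "b \<in> carrier R" "t \<in> S" "c \<in> carrier R"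
      "v \<in> S" "u \<in> S" "w \<in> S" and e: "u \<otimes> (a \<otimes> t) = u \<otimes> (b \<otimes> s)"
      "w \<otimes> (b \<otimes> v) = w \<otimes> (c \<otimes> t)"
      by (auto simp: loc_rel_iff)
    have "(u \<otimes> w \<otimes> t) \<otimes> (a \<otimes> v) = (u \<otimes> (a \<otimes> t)) \<otimes> (w \<otimes> v)" using c by (simp add: m_ac)
    also have "\<dots> = (w \<otimes> (b \<otimes> v)) \<otimes> (u \<otimes> s)" unfolding e(1) using c by (simp add: m_ac)
    also have "\<dots> = (u \<otimes> w \<otimes> t) \<otimes> (c \<otimes> s)" unfolding e(2) using c by (simp add: m_ac)
    finally show "((a, s), (c, v)) \<in> loc_rel R S"
      using c by (auto simp: loc_rel_iff intro!: bexI[of _ "u \<otimes> w \<otimes> t"])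
  qed
qed

lemma fraction_eq_iff:
  assumes "a \<in> carrier R" "s \<in> S" "b \<in> carrier R" "t \<in> S"
  shows "fraction R S a s = fraction R S b t \<longleftrightarrow> (\<exists>u\<in>S. u \<otimes> (a \<otimes> t) = u \<otimes> (b \<otimes> s))"
  unfolding fraction_def using eq_equiv_class_iff[OF equiv_loc_rel, of "(a, s)" "(b, t)"] assms
  by (simp add: loc_rel_iff)

lemma fraction_eqI:
  assumes "u \<otimes> (a \<otimes> t) = u \<otimes> (b \<otimes> s)" "u \<in> S"
    and "a \<in> carrier R" "s \<in> S" "b \<in> carrier R" "t \<in> S"
  shows "fraction R S a s = fraction R S b t"
  using assms by (auto simp: fraction_eq_iff)

lemma fraction_closed [simp]:
  "a \<in> carrier R \<Longrightarrow> s \<in> S \<Longrightarrow> fraction R S a s \<in> carrier (localization R S)"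
  by (auto simp: localization_def fraction_def intro: quotientI)

lemma loc_cases:
  assumes "x \<in> carrier (localization R S)"
  obtains a s where "a \<in> carrier R" "s \<in> S" "x = fraction R S a s"
  using assms by (auto simp: localization_def fraction_def elim!: quotientE)

lemma UN_fraction:
  assumes "a \<in> carrier R" "s \<in> S" and "b \<in> carrier R" "t \<in> S"
    and "\<And>a' s' b' t'. a' \<in> carrier R \<Longrightarrow> s' \<in> S \<Longrightarrow> b' \<in> carrier R \<Longrightarrow> t' \<in> S \<Longrightarrow>
      fraction R S a s = fraction R S a' s' \<Longrightarrow> fraction R S b t = fraction R S b' t' \<Longrightarrow> F a' s' b' t' = F a s b t"
  shows "(\<Union>(a', s')\<in>fraction R S a s. \<Union>(b', t')\<in>fraction R S b t. F a' s' b' t') = F a s b t"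
proof -
  have mem: "c \<in> carrier R \<and> u \<in> S \<and> fraction R S b t = fraction R S c u"
    if "(c, u) \<in> fraction R S b t" for b t c u
    using that equiv_class_eq[OF equiv_loc_rel, of "(b, t)" "(c, u)"]
    by (simp add: fraction_def loc_rel_iff)
  have self: "(b, t) \<in> fraction R S b t" if "b \<in> carrier R" "t \<in> S" for b t
    using equiv_class_self[OF equiv_loc_rel, of "(b, t)"] that by (simp add: fraction_def)
  have "F (fst p) (snd p) (fst q) (snd q) = F a s b t"
    if "p \<in> fraction R S a s" "q \<in> fraction R S b t" for p q
    using assms(5) mem[of "fst p" "snd p" a s] mem[of "fst q" "snd q" b t] that by simp
  moreover have "fraction R S a s \<noteq> {}" "fraction R S b t \<noteq> {}"
    using self assms(1-4) by blast+
  ultimately show ?thesis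
    by (simp add: case_prod_beta cong: SUP_cong)
qed

lemma loc_mult_fraction:
  assumes "a \<in> carrier R" "s \<in> S" "b \<in> carrier R" "t \<in> S"
  shows "fraction R S a s \<otimes>\<^bsub>localization R S\<^esub> fraction R S b t = fraction R S (a \<otimes> b) (s \<otimes> t)"
  unfolding localization_def monoid.simps
proof (rule UN_fraction[OF assms])
  fix a' s' b' t'
  assume c: "a' \<in> carrier R" "s' \<in> S" "b' \<in> carrier R" "t' \<in> S"
    and "fraction R S a s = fraction R S a' s'" "fraction R S b t = fraction R S b' t'"
  then obtain u w where uw: "u \<in> S" "w \<in> S" and e: "u \<otimes> (a \<otimes> s') = u \<otimes> (a' \<otimes> s)"
    "w \<otimes> (b \<otimes> t') = w \<otimes> (b' \<otimes> t)" using assms by (auto simp: fraction_eq_iff)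
  have "(u \<otimes> w) \<otimes> ((a' \<otimes> b') \<otimes> (s \<otimes> t)) = (u \<otimes> (a' \<otimes> s)) \<otimes> (w \<otimes> (b' \<otimes> t))"
    using assms c uw by (simp add: m_ac)
  also have "\<dots> = (u \<otimes> w) \<otimes> ((a \<otimes> b) \<otimes> (s' \<otimes> t'))"
    unfolding e[symmetric] using assms c uw by (simp add: m_ac)
  finally show "fraction R S (a' \<otimes> b') (s' \<otimes> t') = fraction R S (a \<otimes> b) (s \<otimes> t)"
    using assms c uw by (intro fraction_eqI[of "u \<otimes> w"]) simp_all
qed

lemma loc_add_fraction:
  assumes "a \<in> carrier R" "s \<in> S" "b \<in> carrier R" "t \<in> S"
  shows "fraction R S a s \<oplus>\<^bsub>localization R S\<^esub> fraction R S b t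
    = fraction R S (a \<otimes> t \<oplus> b \<otimes> s) (s \<otimes> t)"
  unfolding localization_def ring_record_simps
proof (rule UN_fraction[OF assms])
  fix a' s' b' t'
  assume c: "a' \<in> carrier R" "s' \<in> S" "b' \<in> carrier R" "t' \<in> S"
    and "fraction R S a s = fraction R S a' s'" "fraction R S b t = fraction R S b' t'"
  then obtain u w where uw: "u \<in> S" "w \<in> S" and e: "u \<otimes> (a \<otimes> s') = u \<otimes> (a' \<otimes> s)"
    "w \<otimes> (b \<otimes> t') = w \<otimes> (b' \<otimes> t)" using assms by (auto simp: fraction_eq_iff)
  have "(u \<otimes> w) \<otimes> ((a' \<otimes> t' \<oplus> b' \<otimes> s') \<otimes> (s \<otimes> t))
      = (u \<otimes> (a' \<otimes> s)) \<otimes> (w \<otimes> t \<otimes> t') \<oplus> (w \<otimes> (b' \<otimes> t)) \<otimes> (u \<otimes> s \<otimes> s')"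
    using assms c uw by (simp add: m_ac l_distr r_distr)
  also have "\<dots> = (u \<otimes> w) \<otimes> ((a \<otimes> t \<oplus> b \<otimes> s) \<otimes> (s' \<otimes> t'))"
    unfolding e[symmetric] using assms c uw by (simp add: m_ac l_distr r_distr)
  finally show "fraction R S (a' \<otimes> t' \<oplus> b' \<otimes> s') (s' \<otimes> t') = fraction R S (a \<otimes> t \<oplus> b \<otimes> s) (s \<otimes> t)"
    using assms c uw by (intro fraction_eqI[of "u \<otimes> w"]) simp_all
qed

lemma loc_one: "\<one>\<^bsub>localization R S\<^esub> = fraction R S \<one> \<one>"
  and loc_zero: "\<zero>\<^bsub>localization R S\<^esub> = fraction R S \<zero> \<one>"
  by (simp_all add: localization_def)

lemma fraction_eqI1:
  assumes "a \<in> carrier R" "s \<in> S" "b \<in> carrier R" "t \<in> S" "a \<otimes> t = b \<otimes> s"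
  shows "fraction R S a s = fraction R S b t"
  using assms by (intro fraction_eqI[of \<one>]) simp_all

lemma localization_cring: "cring (localization R S)"
proof -
  let ?L = "localization R S"
  note ops = loc_mult_fraction loc_add_fraction loc_one loc_zero
  have add_assoc: "(x \<oplus>\<^bsub>?L\<^esub> y) \<oplus>\<^bsub>?L\<^esub> z = x \<oplus>\<^bsub>?L\<^esub> (y \<oplus>\<^bsub>?L\<^esub> z)"
    and mult_assoc: "(x \<otimes>\<^bsub>?L\<^esub> y) \<otimes>\<^bsub>?L\<^esub> z = x \<otimes>\<^bsub>?L\<^esub> (y \<otimes>\<^bsub>?L\<^esub> z)"
    and distr: "(x \<oplus>\<^bsub>?L\<^esub> y) \<otimes>\<^bsub>?L\<^esub> z = x \<otimes>\<^bsub>?L\<^esub> z \<oplus>\<^bsub>?L\<^esub> y \<otimes>\<^bsub>?L\<^esub> z"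
    if xyz: "x \<in> carrier ?L" "y \<in> carrier ?L" "z \<in> carrier ?L" for x y z
  proof -
    obtain a s b t c u where c: "a \<in> carrier R" "s \<in> S" "b \<in> carrier R" "t \<in> S" "c \<in> carrier R" "u \<in> S"
      and x: "x = fraction R S a s" "y = fraction R S b t" "z = fraction R S c u"
      using xyz by (metis loc_cases)
    show "(x \<oplus>\<^bsub>?L\<^esub> y) \<oplus>\<^bsub>?L\<^esub> z = x \<oplus>\<^bsub>?L\<^esub> (y \<oplus>\<^bsub>?L\<^esub> z)"
      using c by (simp add: x ops, intro fraction_eqI1) (simp_all add: l_distr r_distr m_ac a_ac)
    show "(x \<otimes>\<^bsub>?L\<^esub> y) \<otimes>\<^bsub>?L\<^esub> z = x \<otimes>\<^bsub>?L\<^esub> (y \<otimes>\<^bsub>?L\<^esub> z)"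
      using c by (simp add: x ops m_assoc)
    show "(x \<oplus>\<^bsub>?L\<^esub> y) \<otimes>\<^bsub>?L\<^esub> z = x \<otimes>\<^bsub>?L\<^esub> z \<oplus>\<^bsub>?L\<^esub> y \<otimes>\<^bsub>?L\<^esub> z"
      using c by (simp add: x ops, intro fraction_eqI1) (simp_all add: l_distr r_distr m_ac)
  qed
  have add_comm: "x \<oplus>\<^bsub>?L\<^esub> y = y \<oplus>\<^bsub>?L\<^esub> x" and mult_comm: "x \<otimes>\<^bsub>?L\<^esub> y = y \<otimes>\<^bsub>?L\<^esub> x"
    and closed: "x \<oplus>\<^bsub>?L\<^esub> y \<in> carrier ?L" "x \<otimes>\<^bsub>?L\<^esub> y \<in> carrier ?L"
    if xy: "x \<in> carrier ?L" "y \<in> carrier ?L" for x y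
  proof -
    obtain a s b t where c: "a \<in> carrier R" "s \<in> S" "b \<in> carrier R" "t \<in> S"
      and x: "x = fraction R S a s" "y = fraction R S b t"
      using xy by (metis loc_cases)
    show "x \<oplus>\<^bsub>?L\<^esub> y = y \<oplus>\<^bsub>?L\<^esub> x" "x \<otimes>\<^bsub>?L\<^esub> y = y \<otimes>\<^bsub>?L\<^esub> x"
      using c by (simp_all add: x ops m_comm a_comm)
    show "x \<oplus>\<^bsub>?L\<^esub> y \<in> carrier ?L" "x \<otimes>\<^bsub>?L\<^esub> y \<in> carrier ?L"
      using c by (simp_all add: x ops)
  qed
  have l_zero: "\<zero>\<^bsub>?L\<^esub> \<oplus>\<^bsub>?L\<^esub> x = x" and l_one: "\<one>\<^bsub>?L\<^esub> \<otimes>\<^bsub>?L\<^esub> x = x"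
    and l_inv: "\<exists>y\<in>carrier ?L. y \<oplus>\<^bsub>?L\<^esub> x = \<zero>\<^bsub>?L\<^esub>"
    if x: "x \<in> carrier ?L" for x
  proof -
    obtain a s where c: "a \<in> carrier R" "s \<in> S" and x: "x = fraction R S a s"
      using x by (rule loc_cases)
    show "\<zero>\<^bsub>?L\<^esub> \<oplus>\<^bsub>?L\<^esub> x = x" "\<one>\<^bsub>?L\<^esub> \<otimes>\<^bsub>?L\<^esub> x = x"
      using c by (simp_all add: x ops)
    have "fraction R S (\<ominus> a) s \<oplus>\<^bsub>?L\<^esub> x = \<zero>\<^bsub>?L\<^esub>"
      using c by (simp add: x ops, intro fraction_eqI1) (simp_all add: l_minus l_neg)
    then show "\<exists>y\<in>carrier ?L. y \<oplus>\<^bsub>?L\<^esub> x = \<zero>\<^bsub>?L\<^esub>"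
      using c by (intro bexI[of _ "fraction R S (\<ominus> a) s"]) simp_all
  qed
  have zero_one: "\<zero>\<^bsub>?L\<^esub> \<in> carrier ?L" "\<one>\<^bsub>?L\<^esub> \<in> carrier ?L"
    by (simp_all add: loc_zero loc_one)
  show ?thesis
  proof (rule cringI)
    show "abelian_group ?L"
      by (rule abelian_groupI)
        (assumption | rule closed zero_one add_assoc add_comm l_zero l_inv)+
    show "comm_monoid ?L"
      by (rule comm_monoidI)
        (assumption | rule closed zero_one mult_assoc mult_comm l_one)+
  qed (rule distr)
qed

lemma loc_map_hom: "loc_map R S \<in> ring_hom R (localization R S)"
  by (rule ring_hom_memI)
    (simp_all add: loc_map_def loc_mult_fraction loc_add_fraction loc_one)

end

lemma anderson_set_mult:
  assumes "cring R"
  shows "cring_mult_set (UP R) (anderson_set R)"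
proof -
  interpret UP_cring R "UP R" using assms by (simp add: UP_cring_def)
  interpret U: cring "UP R" by (rule UP_cring)
  have "submonoid (anderson_set R) (UP R)"
    by (rule submonoid.intro) (auto simp: anderson_set_def)
  then show ?thesis using UP_cring by (simp add: cring_mult_set_def)
qed

lemma anderson_ring_cring: "cring R \<Longrightarrow> cring (anderson_ring R)"
  unfolding anderson_ring_def by (rule cring_mult_set.localization_cring[OF anderson_set_mult])

end

theory Submission
  imports Defs "HOL-Algebra.QuotRing"
begin

text \<open>Write \<open>T\<close> for the Anderson ring of \<open>R\<close>. Two homomorphisms carry the proof: \<open>i : R \<rightarrow> T\<close>, the
  constants, and \<open>e : T \<rightarrow> R\<close>, \<open>f / s \<mapsto> f(0)\<close>. The latter exists by the universal property of
  localizations, because every denominator has constant term \<open>1\<close>. Clearly \<open>e \<circ> i = id\<close>.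

  For the minimal primes, extend along \<open>i\<close>. For a prime \<open>P\<close> of \<open>R\<close>, the
  polynomials with all coefficients in \<open>P\<close> form a prime \<open>P[X]\<close> (\<open>primeideal_coeff_ideal\<close>). It contains no polynomial with constant term \<open>1\<close>, so it
  stays prime in the localization (\<open>primeideal_extension_loc_map\<close>), and its extension there is the
  extension \<open>PT\<close> of \<open>P\<close> along \<open>i\<close> (\<open>base_ext_eq_poly_ext_coeff_ideal\<close>). Since \<open>e\<close> maps \<open>PT\<close>
  into \<open>P\<close>, the contraction of \<open>PT\<close> along \<open>i\<close> is \<open>P\<close> again. A homomorphism that extends primes to
  primes with the right contraction gives a bijection on minimal primes
  (\<open>bij_betw_min_primes_extension\<close>).

  For the maximal ideals, take preimages under \<open>e\<close>. If \<open>e(f / s) = 1\<close>, then \<open>f\<close> is itself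
  an admissible denominator and \<open>s / f\<close> is inverse to \<open>f / s\<close>. So the kernel of the surjection \<open>e\<close> lies in the Jacobson radical of \<open>T\<close>,
  and \<open>M \<mapsto> e\<^sup>-\<^sup>1(M)\<close> is a bijection on maximal ideals (\<open>bij_betw_max_ideals_vimage\<close>). Finally
  \<open>M + XR[X]\<close> consists of the polynomials with constant term in \<open>M\<close> (\<open>plus_X_ideal_eq\<close>), and its
  extension to \<open>T\<close> is \<open>e\<^sup>-\<^sup>1(M)\<close>.\<close>


section \<open>Ideals and ring homomorphisms\<close>

lemma (in cring) ideal_of_closedI:
  assumes "I \<subseteq> carrier R" "\<zero> \<in> I"
    and add: "\<And>a b. a \<in> I \<Longrightarrow> b \<in> I \<Longrightarrow> a \<oplus> b \<in> I"
    and mult: "\<And>r a. r \<in> carrier R \<Longrightarrow> a \<in> I \<Longrightarrow> r \<otimes> a \<in> I"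
  shows "ideal I R"
proof (rule idealI)
  show "ring R" by (rule ring_axioms)
  have neg: "\<ominus> a \<in> I" if "a \<in> I" for a
  proof -
    have "a \<in> carrier R" using that assms(1) by blast
    then have "\<ominus> a = \<ominus> \<one> \<otimes> a" by (simp add: l_minus)
    then show ?thesis using mult[of "\<ominus> \<one>" a] that by simp
  qed
  show "subgroup I (add_monoid R)"
    by (rule subgroup.intro) (use assms neg in \<open>auto simp flip: a_inv_def\<close>)
  show "x \<otimes> a \<in> I" "a \<otimes> x \<in> I" if "a \<in> I" "x \<in> carrier R" for a x
    using mult[of x a] that assms(1) m_comm[of a x] by auto
qed

lemma (in ideal) finsum_mem:
  assumes "finite A" "\<And>i. i \<in> A \<Longrightarrow> f i \<in> I"
  shows "finsum R f A \<in> I"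
  using assms
proof (induction A rule: finite_induct)
  case empty
  then show ?case by simp
next
  case (insert i A)
  then have "f \<in> A \<rightarrow> carrier R" "f i \<in> carrier R" by (auto intro: Icarr)
  with insert show ?case by (simp add: finsum_insert)
qed

lemma (in ring_hom_ring) ideal_image_of_surj:
  assumes surj: "h ` carrier R = carrier S" and "ideal I R"
  shows "ideal (h ` I) S"
proof (rule idealI)
  interpret I: ideal I R by fact
  show "ring S" by (rule S.ring_axioms)
  show "subgroup (h ` I) (add_monoid S)"
  proof (rule subgroup.intro)
    show "h ` I \<subseteq> carrier (add_monoid S)" using I.Icarr by auto
    show "\<one>\<^bsub>add_monoid S\<^esub> \<in> h ` I" by (auto intro!: rev_image_eqI[of \<zero>])
    show "x \<otimes>\<^bsub>add_monoid S\<^esub> y \<in> h ` I" if xy: "x \<in> h ` I" "y \<in> h ` I" for x y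
    proof -
      obtain a b where "a \<in> I" "b \<in> I" "x = h a" "y = h b" using xy by auto
      then show ?thesis by (auto intro!: rev_image_eqI[of "a \<oplus> b"] simp: I.Icarr)
    qed
    show "inv\<^bsub>add_monoid S\<^esub> x \<in> h ` I" if x: "x \<in> h ` I" for x
    proof -
      obtain a where "a \<in> I" "x = h a" using x by auto
      then show ?thesis
        by (auto intro!: rev_image_eqI[of "\<ominus> a"] simp: I.Icarr simp flip: a_inv_def)
    qed
  qed
  show "x \<otimes>\<^bsub>S\<^esub> a \<in> h ` I" "a \<otimes>\<^bsub>S\<^esub> x \<in> h ` I" if ax: "a \<in> h ` I" "x \<in> carrier S" for a x
  proof -
    obtain b y where "b \<in> I" "a = h b" "y \<in> carrier R" "x = h y" using ax unfolding surj[symmetric] by blast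
    then have "x \<otimes>\<^bsub>S\<^esub> a = h (y \<otimes> b)" "a \<otimes>\<^bsub>S\<^esub> x = h (b \<otimes> y)" "y \<otimes> b \<in> I" "b \<otimes> y \<in> I"
      by (simp_all add: I.Icarr I.I_l_closed I.I_r_closed)
    then show "x \<otimes>\<^bsub>S\<^esub> a \<in> h ` I" "a \<otimes>\<^bsub>S\<^esub> x \<in> h ` I" by simp_all
  qed
qed

text \<open>The hypothesis on units says that the kernel lies in the Jacobson radical: an ideal \<open>N\<close> with
  \<open>h ` N = S\<close> contains a preimage of \<open>\<one>\<close>, hence a unit. So the image of a maximal ideal is
  proper, and a maximal ideal is the preimage of its image.\<close>
lemma (in ring_hom_ring) bij_betw_max_ideals_vimage:
  assumes surj: "h ` carrier R = carrier S"
    and units: "\<And>x. x \<in> carrier R \<Longrightarrow> h x = \<one>\<^bsub>S\<^esub> \<Longrightarrow> x \<in> Units R"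
  shows "bij_betw (\<lambda>M. {x \<in> carrier R. h x \<in> M}) (max_ideals S) (max_ideals R)"
proof (rule bij_betw_byWitness[where f' = "\<lambda>N. h ` N"])
  have img_vim: "h ` {x \<in> carrier R. h x \<in> M} = M" if "M \<subseteq> carrier S" for M
    using that unfolding surj[symmetric] by auto
  show "\<forall>M\<in>max_ideals S. h ` {x \<in> carrier R. h x \<in> M} = M"
    using img_vim by (auto simp: max_ideals_def maximalideal_def ideal_def dest: additive_subgroup.a_subset)
  have full: "J = carrier R" if J: "ideal J R" "h ` J = carrier S" for J
  proof -
    interpret J: ideal J R by (rule J(1))
    obtain x where x: "x \<in> J" "h x = \<one>\<^bsub>S\<^esub>" using J(2) by (metis S.one_closed imageE)
    then have "x \<in> Units R" using units J.Icarr by auto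
    then have "\<one> \<in> J" using J.I_l_closed[OF x(1)] by (metis R.Units_inv_closed R.Units_l_inv)
    then show ?thesis using J.one_imp_carrier by simp
  qed
  have proper: "h ` N \<noteq> carrier S" if "maximalideal N R" for N
    using full[of N] that by (auto simp: maximalideal_def maximalideal_axioms_def)
  have vim_img: "{x \<in> carrier R. h x \<in> h ` N} = N" if N: "maximalideal N R" for N
  proof -
    interpret N: maximalideal N R by fact
    have "ideal {x \<in> carrier R. h x \<in> h ` N} R"
      by (intro ideal_vimage ideal_image_of_surj surj N.is_ideal)
    then have "{x \<in> carrier R. h x \<in> h ` N} = N \<or> {x \<in> carrier R. h x \<in> h ` N} = carrier R"
      by (rule N.I_maximal) (use N.Icarr in auto)
    then show ?thesis
    proof
      assume "{x \<in> carrier R. h x \<in> h ` N} = carrier R"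
      then have "h ` carrier R \<subseteq> h ` N" by blast
      then have "carrier S \<subseteq> h ` N" unfolding surj .
      moreover have "h ` N \<subseteq> carrier S" using N.Icarr by auto
      ultimately show ?thesis using proper[OF N] by blast
    qed
  qed
  then show "\<forall>N\<in>max_ideals R. {x \<in> carrier R. h x \<in> h ` N} = N"
    by (simp add: max_ideals_def)
  show "(\<lambda>M. {x \<in> carrier R. h x \<in> M}) ` max_ideals S \<subseteq> max_ideals R"
  proof clarsimp
    fix M assume "M \<in> max_ideals S"
    then interpret M: maximalideal M S by (simp add: max_ideals_def)
    let ?V = "{x \<in> carrier R. h x \<in> M}"
    have V: "h ` ?V = M" by (rule img_vim) (use M.Icarr in auto)
    show "?V \<in> max_ideals R" unfolding max_ideals_def mem_Collect_eq
    proof (rule maximalidealI)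
      show "ideal ?V R" by (rule ideal_vimage) (rule M.is_ideal)
      show "carrier R \<noteq> ?V" using V surj M.I_notcarr by metis
      fix J assume J: "ideal J R" "?V \<subseteq> J" "J \<subseteq> carrier R"
      have "h ` ?V \<subseteq> h ` J" using J(2) by blast
      then have "M \<subseteq> h ` J" unfolding V .
      moreover have "h ` J \<subseteq> carrier S" using J(3) by auto
      ultimately consider "h ` J = M" | "h ` J = carrier S"
        using M.I_maximal[OF ideal_image_of_surj[OF surj J(1)]] by blast
      then show "J = ?V \<or> J = carrier R"
      proof cases
        case 1
        then show ?thesis using J by blast
      next
        case 2
        then show ?thesis using full[OF J(1)] by simp
      qed
    qed
  qed
  show "(\<lambda>N. h ` N) ` max_ideals R \<subseteq> max_ideals S"
  proof clarsimp
    fix N assume "N \<in> max_ideals R"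
    then have N: "maximalideal N R" by (simp add: max_ideals_def)
    interpret N: maximalideal N R by fact
    show "h ` N \<in> max_ideals S" unfolding max_ideals_def mem_Collect_eq
    proof (rule maximalidealI)
      show "ideal (h ` N) S" by (rule ideal_image_of_surj[OF surj N.is_ideal])
      show "carrier S \<noteq> h ` N" using proper[OF N] by blast
      fix J assume J: "ideal J S" "h ` N \<subseteq> J" "J \<subseteq> carrier S"
      let ?V = "{x \<in> carrier R. h x \<in> J}"
      have "?V = N \<or> ?V = carrier R"
        by (rule N.I_maximal[OF ideal_vimage[OF J(1)]]) (use J N.Icarr in auto)
      then have "h ` ?V = h ` N \<or> h ` ?V = h ` carrier R"
        by (rule disj_forward) (erule arg_cong)+
      then show "J = h ` N \<or> J = carrier S" unfolding img_vim[OF J(3)] surj .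
    qed
  qed
qed

lemma (in ring_hom_ring) ideal_extension_minimal:
  assumes "ideal J S" "h ` I \<subseteq> J"
  shows "ideal_extension S h I \<subseteq> J"
  unfolding ideal_extension_def by (rule S.genideal_minimal[OF assms])

lemma (in ring_hom_ring) ideal_ideal_extension:
  assumes "I \<subseteq> carrier R"
  shows "ideal (ideal_extension S h I) S" "h ` I \<subseteq> ideal_extension S h I"
proof -
  have "h ` I \<subseteq> carrier S" using assms by auto
  then show "ideal (ideal_extension S h I) S" "h ` I \<subseteq> ideal_extension S h I"
    unfolding ideal_extension_def by (simp_all add: S.genideal_ideal S.genideal_self)
qed

text \<open>The preimage of \<open>I\<close> under the retraction \<open>k\<close> is an ideal of \<open>S\<close> that contains \<open>h ` I\<close>, hence
  contains the extension of \<open>I\<close>. So \<open>k\<close> sends the extension back into \<open>I\<close>.\<close>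
lemma (in ring_hom_ring) contraction_of_extension_of_retract:
  assumes k: "k \<in> ring_hom S R" "\<And>r. r \<in> carrier R \<Longrightarrow> k (h r) = r" and I: "ideal I R"
  shows "{r \<in> carrier R. h r \<in> ideal_extension S h I} = I"
proof -
  interpret k: ring_hom_ring S R k
    by (rule ring_hom_ringI2[OF S.ring_axioms R.ring_axioms k(1)])
  interpret I: ideal I R by fact
  have "I \<subseteq> carrier R" using I.Icarr by auto
  note ext = ideal_ideal_extension[OF this]
  have "ideal_extension S h I \<subseteq> {x \<in> carrier S. k x \<in> I}"
    by (rule ideal_extension_minimal[OF k.ideal_vimage[OF I]]) (auto simp: I.Icarr k(2))
  then show ?thesis using ext(2) I.Icarr k(2) by fastforce
qed

text \<open>Contraction inverts extension: for a minimal prime \<open>Q\<close> of \<open>S\<close>, the extension of its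
  contraction is a prime inside \<open>Q\<close>, so equal to \<open>Q\<close>.\<close>
lemma (in ring_hom_ring) bij_betw_min_primes_extension:
  assumes cR: "cring R"
    and ext: "\<And>I. primeideal I R \<Longrightarrow> primeideal (ideal_extension S h I) S"
    and contr: "\<And>I. primeideal I R \<Longrightarrow> {r \<in> carrier R. h r \<in> ideal_extension S h I} = I"
  shows "bij_betw (ideal_extension S h) (min_primes R) (min_primes S)"
proof (rule bij_betw_byWitness[where f' = "\<lambda>Q. {r \<in> carrier R. h r \<in> Q}"])
  have ext_contr: "ideal_extension S h {r \<in> carrier R. h r \<in> Q} \<subseteq> Q" if "primeideal Q S" for Q
    by (rule ideal_extension_minimal) (use that in \<open>auto intro: primeideal.axioms\<close>)
  note contr_prime = primeideal_vimage[OF cR]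
  have mono: "ideal_extension S h I \<subseteq> ideal_extension S h J" if "I \<subseteq> J" "primeideal J R" for I J
  proof -
    have "J \<subseteq> carrier R" using that(2) by (metis additive_subgroup.a_subset ideal_def primeideal_def)
    from ideal_ideal_extension[OF this] show ?thesis
      by (intro ideal_extension_minimal) (use that in auto)
  qed
  show "\<forall>I\<in>min_primes R. {r \<in> carrier R. h r \<in> ideal_extension S h I} = I"
    using contr by (simp add: min_primes_def)
  have inv: "ideal_extension S h {r \<in> carrier R. h r \<in> Q} = Q" if "Q \<in> min_primes S" for Q
    using that ext_contr[of Q] ext[OF contr_prime[of Q]] by (simp add: min_primes_def)
  then show "\<forall>Q\<in>min_primes S. ideal_extension S h {r \<in> carrier R. h r \<in> Q} = Q" by blast
  show "ideal_extension S h ` min_primes R \<subseteq> min_primes S"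
  proof clarify
    fix I assume I: "I \<in> min_primes R"
    then have I': "primeideal I R" by (simp add: min_primes_def)
    show "ideal_extension S h I \<in> min_primes S" unfolding min_primes_def
    proof (clarify, intro conjI allI impI)
      show "primeideal (ideal_extension S h I) S" by (rule ext[OF I'])
      fix Q assume Q: "primeideal Q S \<and> Q \<subseteq> ideal_extension S h I"
      then have "{r \<in> carrier R. h r \<in> Q} \<subseteq> I" using contr[OF I'] by blast
      then have "{r \<in> carrier R. h r \<in> Q} = I"
        using I contr_prime[of Q] Q by (simp add: min_primes_def)
      then show "Q = ideal_extension S h I" using ext_contr[of Q] Q by auto
    qed
  qed
  show "(\<lambda>Q. {r \<in> carrier R. h r \<in> Q}) ` min_primes S \<subseteq> min_primes R"
  proof clarify
    fix Q assume Q: "Q \<in> min_primes S"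
    then have Q': "primeideal Q S" by (simp add: min_primes_def)
    let ?C = "{r \<in> carrier R. h r \<in> Q}"
    show "?C \<in> min_primes R" unfolding min_primes_def
    proof (clarify, intro conjI allI impI)
      show C: "primeideal ?C R" by (rule contr_prime[OF Q'])
      fix J assume J: "primeideal J R \<and> J \<subseteq> ?C"
      then have "ideal_extension S h J \<subseteq> Q" using mono[of J ?C] C inv[OF Q] by auto
      then have "ideal_extension S h J = Q" using Q ext[of J] J by (simp add: min_primes_def)
      then show "J = ?C" using contr[of J] J by simp
    qed
  qed
qed


section \<open>Ideals and homomorphisms of a localization\<close>

context cring_mult_set
begin

lemma ring_hom_ring_loc_map: "ring_hom_ring R (localization R S) (loc_map R S)"
  by (rule ring_hom_ringI2[OF ring_axioms cring.axioms(1)[OF localization_cring] loc_map_hom])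

text \<open>Sums of fractions with numerator in \<open>I\<close> are again such fractions, since \<open>a / s + b / t\<close> has the
  numerator \<open>at + bs\<close>; and \<open>a / s\<close> is the multiple of \<open>a / 1\<close> by \<open>1 / s\<close>.\<close>
lemma ideal_extension_loc_map:
  assumes "ideal I R"
  shows "ideal_extension (localization R S) (loc_map R S) I = {fraction R S a s | a s. a \<in> I \<and> s \<in> S}"
    (is "?E = ?F")
proof
  interpret L: cring "localization R S" by (rule localization_cring)
  interpret loc: ring_hom_ring R "localization R S" "loc_map R S" by (rule ring_hom_ring_loc_map)
  interpret I: ideal I R by fact
  have "I \<subseteq> carrier R" using I.Icarr by auto
  note E = loc.ideal_ideal_extension[OF this]
  show "?E \<subseteq> ?F"
  proof (rule loc.ideal_extension_minimal)
    have one: "\<one> \<in> S" by simp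
    then show "loc_map R S ` I \<subseteq> ?F" unfolding loc_map_def by blast
    show "ideal ?F (localization R S)"
    proof (rule L.ideal_of_closedI)
      show "?F \<subseteq> carrier (localization R S)" by (auto simp: I.Icarr)
      show "\<zero>\<^bsub>localization R S\<^esub> \<in> ?F" unfolding loc_zero using one I.zero_closed by blast
      show "x \<oplus>\<^bsub>localization R S\<^esub> y \<in> ?F" if "x \<in> ?F" "y \<in> ?F" for x y
      proof -
        from that obtain a s b t where c: "a \<in> I" "s \<in> S" "b \<in> I" "t \<in> S"
          and xy: "x = fraction R S a s" "y = fraction R S b t" by blast
        have "x \<oplus>\<^bsub>localization R S\<^esub> y = fraction R S (a \<otimes> t \<oplus> b \<otimes> s) (s \<otimes> t)"
          using c by (simp add: xy loc_add_fraction I.Icarr)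
        moreover have "a \<otimes> t \<oplus> b \<otimes> s \<in> I" using c by (simp add: I.I_r_closed)
        ultimately show ?thesis using c by blast
      qed
      show "r \<otimes>\<^bsub>localization R S\<^esub> x \<in> ?F" if r: "r \<in> carrier (localization R S)" "x \<in> ?F" for r x
      proof -
        from r obtain a s b t where c: "a \<in> carrier R" "s \<in> S" "b \<in> I" "t \<in> S"
          and xy: "r = fraction R S a s" "x = fraction R S b t" by (auto elim!: loc_cases)
        have "r \<otimes>\<^bsub>localization R S\<^esub> x = fraction R S (a \<otimes> b) (s \<otimes> t)"
          using c by (simp add: xy loc_mult_fraction I.Icarr)
        moreover have "a \<otimes> b \<in> I" using c by (simp add: I.I_l_closed)
        ultimately show ?thesis using c by blast
      qed
    qed
  qed
  show "?F \<subseteq> ?E"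
  proof clarify
    fix a s assume as: "a \<in> I" "s \<in> S"
    have "fraction R S a s = fraction R S \<one> s \<otimes>\<^bsub>localization R S\<^esub> loc_map R S a"
      using as by (simp add: loc_map_def loc_mult_fraction I.Icarr)
    moreover have "\<dots> \<in> ?E"
      by (rule ideal.I_l_closed[OF E(1)]) (use as E(2) in auto)
    ultimately show "fraction R S a s \<in> ?E" by simp
  qed
qed

text \<open>A prime disjoint from \<open>S\<close> is saturated: if \<open>a / s = b / t\<close> with \<open>b \<in> I\<close>, then some product of
  \<open>a\<close> with elements of \<open>S\<close> lies in \<open>I\<close>, and those factors can be cancelled. This makes membership
  independent of the representative, which gives the primality of the extension below.\<close>
lemma fraction_mem_extension_iff:
  assumes "primeideal I R" "I \<inter> S = {}" "a \<in> carrier R" "s \<in> S"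
  shows "fraction R S a s \<in> ideal_extension (localization R S) (loc_map R S) I \<longleftrightarrow> a \<in> I"
proof -
  interpret I: primeideal I R by fact
  have "a \<in> I" if e: "fraction R S a s = fraction R S b t" and b: "b \<in> I" "t \<in> S" for b t
  proof -
    obtain u where u: "u \<in> S" "u \<otimes> (a \<otimes> t) = u \<otimes> (b \<otimes> s)"
      using e b assms by (auto simp: fraction_eq_iff I.Icarr)
    then have "u \<otimes> (a \<otimes> t) \<in> I" using b assms by (simp add: I.I_l_closed I.I_r_closed)
    then have "u \<in> I \<or> a \<otimes> t \<in> I" using u b assms(3) by (intro I.I_prime) auto
    then have "a \<otimes> t \<in> I" using u assms(2) by blast
    then have "a \<in> I \<or> t \<in> I" using b assms(3) by (intro I.I_prime) auto
    then show "a \<in> I" using b assms(2) by blast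
  qed
  then show ?thesis using assms by (auto simp: ideal_extension_loc_map[OF I.is_ideal])
qed

lemma primeideal_extension_loc_map:
  assumes "primeideal I R" "I \<inter> S = {}"
  shows "primeideal (ideal_extension (localization R S) (loc_map R S) I) (localization R S)"
proof (rule primeidealI)
  interpret I: primeideal I R by fact
  interpret loc: ring_hom_ring R "localization R S" "loc_map R S" by (rule ring_hom_ring_loc_map)
  note mem_iff = fraction_mem_extension_iff[OF assms]
  show "ideal (ideal_extension (localization R S) (loc_map R S) I) (localization R S)"
    by (rule loc.ideal_ideal_extension) (use I.Icarr in auto)
  show "cring (localization R S)" by (rule localization_cring)
  have one_mem: "\<one> \<in> S" by simp
  then have "\<one> \<notin> I" using assms(2) by blast
  then have "fraction R S \<one> \<one> \<notin> ideal_extension (localization R S) (loc_map R S) I"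
    using mem_iff one_mem S_carr by blast
  moreover have "fraction R S \<one> \<one> \<in> carrier (localization R S)" by simp
  ultimately show "carrier (localization R S) \<noteq> ideal_extension (localization R S) (loc_map R S) I"
    by blast
  fix x y assume xy: "x \<in> carrier (localization R S)" "y \<in> carrier (localization R S)"
    "x \<otimes>\<^bsub>localization R S\<^esub> y \<in> ideal_extension (localization R S) (loc_map R S) I"
  obtain a s b t where c: "a \<in> carrier R" "s \<in> S" "b \<in> carrier R" "t \<in> S"
    and x: "x = fraction R S a s" "y = fraction R S b t"
    using xy by (metis loc_cases)
  have "a \<otimes> b \<in> I" using xy(3) c by (simp add: x loc_mult_fraction mem_iff)
  then show "x \<in> ideal_extension (localization R S) (loc_map R S) I \<or>
      y \<in> ideal_extension (localization R S) (loc_map R S) I"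
    using I.I_prime c by (auto simp: x mem_iff)
qed

text \<open>The existence half of the universal property of \<open>S\<^sup>-\<^sup>1R\<close>.\<close>
lemma localization_lift:
  assumes "cring B" and h: "h \<in> ring_hom R B" and units: "\<And>s. s \<in> S \<Longrightarrow> h s \<in> Units B"
  obtains g where "g \<in> ring_hom (localization R S) B"
    "\<And>a s. a \<in> carrier R \<Longrightarrow> s \<in> S \<Longrightarrow> g (fraction R S a s) = h a \<otimes>\<^bsub>B\<^esub> inv\<^bsub>B\<^esub> (h s)"
proof -
  interpret B: cring B by fact
  interpret h: ring_hom_ring R B h by (rule ring_hom_ringI2[OF ring_axioms B.ring_axioms h])
  define v where "v a s = h a \<otimes>\<^bsub>B\<^esub> inv\<^bsub>B\<^esub> (h s)" for a s
  have v_closed: "v a s \<in> carrier B" if "a \<in> carrier R" "s \<in> S" for a s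
    using that units by (simp add: v_def)
  have v_cancel: "v a s \<otimes>\<^bsub>B\<^esub> h s = h a" if "a \<in> carrier R" "s \<in> S" for a s
    using that units[of s] by (simp add: v_def B.m_assoc)
  \<comment> \<open>cross-multiplication: it yields independence of the representative, and the compatibility
    with products and sums\<close>
  have v_unique: "v a s = x" if "x \<otimes>\<^bsub>B\<^esub> h s = h a" "x \<in> carrier B" "a \<in> carrier R" "s \<in> S" for x a s
    using that units[of s] by (simp add: v_def B.m_assoc flip: that(1))
  have v_cong: "v a s = v b t" if c: "a \<in> carrier R" "s \<in> S" "b \<in> carrier R" "t \<in> S"
    and e: "fraction R S a s = fraction R S b t" for a s b t
  proof -
    obtain u where u: "u \<in> S" "u \<otimes> (a \<otimes> t) = u \<otimes> (b \<otimes> s)" using e c by (auto simp: fraction_eq_iff)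
    then have "h (u \<otimes> (a \<otimes> t)) = h (u \<otimes> (b \<otimes> s))" by simp
    then have "h u \<otimes>\<^bsub>B\<^esub> (h a \<otimes>\<^bsub>B\<^esub> h t) = h u \<otimes>\<^bsub>B\<^esub> (h b \<otimes>\<^bsub>B\<^esub> h s)" using u(1) c by simp
    then have e': "h a \<otimes>\<^bsub>B\<^esub> h t = h b \<otimes>\<^bsub>B\<^esub> h s"
      using B.Units_l_cancel[OF units[OF u(1)]] c by simp
    have "(v b t \<otimes>\<^bsub>B\<^esub> h s) \<otimes>\<^bsub>B\<^esub> h t = (v b t \<otimes>\<^bsub>B\<^esub> h t) \<otimes>\<^bsub>B\<^esub> h s"
      using c v_closed[of b t] by (simp add: B.m_ac)
    also have "\<dots> = h a \<otimes>\<^bsub>B\<^esub> h t" using c by (simp add: v_cancel e')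
    finally have "h t \<otimes>\<^bsub>B\<^esub> (v b t \<otimes>\<^bsub>B\<^esub> h s) = h t \<otimes>\<^bsub>B\<^esub> h a"
      using c v_closed[of b t] by (simp add: B.m_comm)
    then have "v b t \<otimes>\<^bsub>B\<^esub> h s = h a"
      using B.Units_l_cancel[OF units[OF c(4)]] c v_closed[of b t] by simp
    then show ?thesis by (rule v_unique) (use c v_closed in auto)
  qed
  define g where "g x = (THE y. \<exists>a s. a \<in> carrier R \<and> s \<in> S \<and> x = fraction R S a s \<and> y = v a s)" for x
  have g: "g (fraction R S a s) = v a s" if "a \<in> carrier R" "s \<in> S" for a s
    unfolding g_def by (rule the_equality) (use that v_cong in blast)+
  have "g \<in> ring_hom (localization R S) B"
  proof (rule ring_hom_memI)
    show "g x \<in> carrier B" if "x \<in> carrier (localization R S)" for x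
      using that by (auto elim!: loc_cases simp: g v_closed)
    show "g \<one>\<^bsub>localization R S\<^esub> = \<one>\<^bsub>B\<^esub>" by (simp add: loc_one g v_def)
    fix x y assume xy: "x \<in> carrier (localization R S)" "y \<in> carrier (localization R S)"
    obtain a s b t where c: "a \<in> carrier R" "s \<in> S" "b \<in> carrier R" "t \<in> S"
      and x: "x = fraction R S a s" "y = fraction R S b t"
      using xy by (metis loc_cases)
    note [simp] = v_closed[OF c(1,2)] v_closed[OF c(3,4)]
    have "v (a \<otimes> b) (s \<otimes> t) = v a s \<otimes>\<^bsub>B\<^esub> v b t"
    proof (rule v_unique)
      have "v a s \<otimes>\<^bsub>B\<^esub> v b t \<otimes>\<^bsub>B\<^esub> h (s \<otimes> t) = (v a s \<otimes>\<^bsub>B\<^esub> h s) \<otimes>\<^bsub>B\<^esub> (v b t \<otimes>\<^bsub>B\<^esub> h t)"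
        using c by (simp add: B.m_ac)
      then show "v a s \<otimes>\<^bsub>B\<^esub> v b t \<otimes>\<^bsub>B\<^esub> h (s \<otimes> t) = h (a \<otimes> b)"
        using c by (simp add: v_cancel)
    qed (use c in auto)
    then show "g (x \<otimes>\<^bsub>localization R S\<^esub> y) = g x \<otimes>\<^bsub>B\<^esub> g y"
      using c by (simp add: x loc_mult_fraction g)
    have "v (a \<otimes> t \<oplus> b \<otimes> s) (s \<otimes> t) = v a s \<oplus>\<^bsub>B\<^esub> v b t"
    proof (rule v_unique)
      have "(v a s \<oplus>\<^bsub>B\<^esub> v b t) \<otimes>\<^bsub>B\<^esub> h (s \<otimes> t)
          = (v a s \<otimes>\<^bsub>B\<^esub> h s) \<otimes>\<^bsub>B\<^esub> h t \<oplus>\<^bsub>B\<^esub> (v b t \<otimes>\<^bsub>B\<^esub> h t) \<otimes>\<^bsub>B\<^esub> h s"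
        using c by (simp add: B.l_distr B.r_distr B.m_ac)
      then show "(v a s \<oplus>\<^bsub>B\<^esub> v b t) \<otimes>\<^bsub>B\<^esub> h (s \<otimes> t) = h (a \<otimes> t \<oplus> b \<otimes> s)"
        using c by (simp add: v_cancel)
    qed (use c in auto)
    then show "g (x \<oplus>\<^bsub>localization R S\<^esub> y) = g x \<oplus>\<^bsub>B\<^esub> g y"
      using c by (simp add: x loc_add_fraction g)
  qed
  then show thesis using that g by (simp add: v_def)
qed

end


section \<open>Ideals of the polynomial ring\<close>

text \<open>For an ideal \<open>I\<close> this is the ideal usually written \<open>I[X]\<close>.\<close>
definition coeff_ideal :: "('a, 'm) ring_scheme \<Rightarrow> 'a set \<Rightarrow> (nat \<Rightarrow> 'a) set"
  where "coeff_ideal R I = {f \<in> carrier (UP R). \<forall>n. coeff (UP R) f n \<in> I}"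

context UP_cring
begin

lemma mem_ideal_of_monoms:
  assumes "ideal J P" "f \<in> carrier P" "\<And>n. monom P (coeff P f n) n \<in> J"
  shows "f \<in> J"
  using ideal.finsum_mem[OF assms(1), of "{..deg R f}" "\<lambda>n. monom P (coeff P f n) n"]
  by (simp add: assms up_repr)

lemma monom_eq_mult_const: "a \<in> carrier R \<Longrightarrow> monom P a n = monom P \<one> n \<otimes>\<^bsub>P\<^esub> monom P a 0"
  using monom_mult[OF R.one_closed, of a n 0] by (simp only: R.l_one add_0_right)

lemma ideal_coeff_ideal:
  assumes "ideal I R"
  shows "ideal (coeff_ideal R I) P"
proof (rule P.ideal_of_closedI)
  interpret I: ideal I R by fact
  note d = coeff_ideal_def[of R I, folded P_def]
  show "coeff_ideal R I \<subseteq> carrier P" "\<zero>\<^bsub>P\<^esub> \<in> coeff_ideal R I" by (auto simp: d)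
  show "a \<oplus>\<^bsub>P\<^esub> b \<in> coeff_ideal R I" if "a \<in> coeff_ideal R I" "b \<in> coeff_ideal R I" for a b
    using that by (auto simp: d)
  show "r \<otimes>\<^bsub>P\<^esub> a \<in> coeff_ideal R I" if "r \<in> carrier P" "a \<in> coeff_ideal R I" for r a
    using that by (auto simp: d intro!: I.finsum_mem I.I_l_closed)
qed

text \<open>The constants from \<open>I\<close> generate \<open>I[X]\<close>, because \<open>aX\<^sup>n\<close> is a multiple of the constant \<open>a\<close>.\<close>
lemma coeff_ideal_subset_of_const:
  assumes "ideal J P" "I \<subseteq> carrier R" "\<And>a. a \<in> I \<Longrightarrow> monom P a 0 \<in> J"
  shows "coeff_ideal R I \<subseteq> J"
proof
  fix f assume "f \<in> coeff_ideal R I"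
  then have f: "f \<in> carrier P" "\<And>n. coeff P f n \<in> I" by (auto simp: coeff_ideal_def P_def)
  show "f \<in> J"
  proof (rule mem_ideal_of_monoms[OF assms(1) f(1)])
    fix n
    have "monom P \<one> n \<otimes>\<^bsub>P\<^esub> monom P (coeff P f n) 0 \<in> J"
      by (rule ideal.I_l_closed[OF assms(1) assms(3)]) (use f in auto)
    then show "monom P (coeff P f n) n \<in> J" using f by (simp flip: monom_eq_mult_const)
  qed
qed

text \<open>Gauss's argument: if \<open>n\<close> and \<open>m\<close> are the least indices of coefficients of \<open>f\<close> and \<open>g\<close> outside
  \<open>I\<close>, then in the coefficient of \<open>fg\<close> at \<open>n + m\<close> every summand except \<open>f\<^sub>n g\<^sub>m\<close> lies in \<open>I\<close>, so the
  whole coefficient does not.\<close>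
lemma primeideal_coeff_ideal:
  assumes "primeideal I R"
  shows "primeideal (coeff_ideal R I) P"
proof (rule primeidealI)
  interpret I: primeideal I R by fact
  note d = coeff_ideal_def[of R I, folded P_def]
  show "ideal (coeff_ideal R I) P" by (rule ideal_coeff_ideal[OF I.is_ideal])
  show "cring P" by (rule UP_cring)
  have "\<one> \<notin> I" using I.one_imp_carrier I.I_notcarr by auto
  then have "\<one>\<^bsub>P\<^esub> \<notin> coeff_ideal R I" by (auto simp: d)
  then show "carrier P \<noteq> coeff_ideal R I" by auto
  fix f g assume fg: "f \<in> carrier P" "g \<in> carrier P" "f \<otimes>\<^bsub>P\<^esub> g \<in> coeff_ideal R I"
  show "f \<in> coeff_ideal R I \<or> g \<in> coeff_ideal R I"
  proof (rule ccontr)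
    assume "\<not> ?thesis"
    then have ex: "\<exists>n. coeff P f n \<notin> I" "\<exists>n. coeff P g n \<notin> I" using fg by (auto simp: d)
    define n where "n = (LEAST n. coeff P f n \<notin> I)"
    define m where "m = (LEAST n. coeff P g n \<notin> I)"
    have n: "coeff P f n \<notin> I" "\<And>i. i < n \<Longrightarrow> coeff P f i \<in> I"
      using LeastI_ex[OF ex(1)] not_less_Least by (auto simp: n_def)
    have m: "coeff P g m \<notin> I" "\<And>i. i < m \<Longrightarrow> coeff P g i \<in> I"
      using LeastI_ex[OF ex(2)] not_less_Least by (auto simp: m_def)
    let ?t = "\<lambda>i. coeff P f i \<otimes> coeff P g (n + m - i)"
    let ?rest = "finsum R ?t ({..n + m} - {n})"
    have rest: "?rest \<in> I"
    proof (rule I.finsum_mem)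
      fix i assume i: "i \<in> {..n + m} - {n}"
      then consider "i < n" | "n + m - i < m" by fastforce
      then show "?t i \<in> I"
        by cases (use n m fg in \<open>auto intro: I.I_l_closed I.I_r_closed\<close>)
    qed simp
    have "coeff P (f \<otimes>\<^bsub>P\<^esub> g) (n + m) = finsum R ?t (insert n ({..n + m} - {n}))"
      using fg by (simp add: insert_absorb)
    also have "\<dots> = ?t n \<oplus> ?rest"
      using fg by (subst R.finsum_insert) auto
    finally have sum: "coeff P (f \<otimes>\<^bsub>P\<^esub> g) (n + m) = ?t n \<oplus> ?rest" .
    have "coeff P (f \<otimes>\<^bsub>P\<^esub> g) (n + m) \<in> I" using fg(3) unfolding d by blast
    then have "?t n \<oplus> ?rest \<in> I" unfolding sum .
    then have "(?t n \<oplus> ?rest) \<ominus> ?rest \<in> I" using rest by (simp add: a_minus_def)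
    moreover have "(?t n \<oplus> ?rest) \<ominus> ?rest = ?t n"
      using fg rest I.Icarr by (simp add: a_minus_def R.a_assoc R.r_neg)
    ultimately have "coeff P f n \<otimes> coeff P g m \<in> I" by simp
    then show False using I.I_prime[of "coeff P f n" "coeff P g m"] n(1) m(1) fg(1,2) by simp
  qed
qed

lemma coeff_0_ring_hom: "(\<lambda>f. coeff P f 0) \<in> ring_hom P R"
  by (rule ring_hom_memI) auto

text \<open>A polynomial minus its constant term has only monomials divisible by \<open>X\<close>.\<close>
lemma plus_X_ideal_eq:
  assumes "ideal I R"
  shows "plus_X_ideal R I = {f \<in> carrier P. coeff P f 0 \<in> I}" (is "?L = ?K")
proof
  interpret I: ideal I R by fact
  let ?X = "monom P \<one> 1"
  have X: "ideal (PIdl\<^bsub>P\<^esub> ?X) P" by (rule P.cgenideal_ideal) simp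
  have L: "?L = {monom P a 0 \<oplus>\<^bsub>P\<^esub> x | a x. a \<in> I \<and> x \<in> PIdl\<^bsub>P\<^esub> ?X}"
    by (auto simp: plus_X_ideal_def const_poly_def set_add_defs P_def)
  show "?L \<subseteq> ?K" unfolding L by (auto simp: cgenideal_def I.Icarr)
  show "?K \<subseteq> ?L"
  proof
    fix f assume "f \<in> ?K"
    then have f: "f \<in> carrier P" "coeff P f 0 \<in> I" by auto
    let ?c = "monom P (coeff P f 0) 0"
    have "f \<ominus>\<^bsub>P\<^esub> ?c \<in> PIdl\<^bsub>P\<^esub> ?X"
    proof (rule mem_ideal_of_monoms[OF X])
      fix n
      let ?a = "coeff P (f \<ominus>\<^bsub>P\<^esub> ?c) n"
      have a: "?a \<in> carrier R" using f by simp
      show "monom P ?a n \<in> PIdl\<^bsub>P\<^esub> ?X"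
      proof (cases n)
        case 0
        then have "?a = \<zero>" using f by (simp add: coeff_minus R.r_neg a_minus_def)
        then show ?thesis using X by (simp add: additive_subgroup.zero_closed ideal.axioms(1))
      next
        case (Suc k)
        then have "monom P ?a n = monom P ?a k \<otimes>\<^bsub>P\<^esub> ?X"
          using monom_mult[OF a R.one_closed, of k 1] a by simp
        then show ?thesis using a by (auto simp: cgenideal_def)
      qed
    qed (use f in simp)
    moreover have "f = ?c \<oplus>\<^bsub>P\<^esub> (f \<ominus>\<^bsub>P\<^esub> ?c)"
      using f by (simp add: a_minus_def P.a_lcomm P.r_neg)
    ultimately show "f \<in> ?L" unfolding L using f(2) by blast
  qed
qed

end


section \<open>The Anderson ring\<close>

text \<open>Evaluation at \<open>X = 0\<close> sends every denominator to the unit \<open>1\<close>, so it factors through the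
  localization.\<close>
lemma anderson_constant_term:
  fixes R (structure)
  assumes "cring R"
  obtains e where "e \<in> ring_hom (anderson_ring R) R"
    "\<And>f s. f \<in> carrier (UP R) \<Longrightarrow> s \<in> anderson_set R \<Longrightarrow>
      e (fraction (UP R) (anderson_set R) f s) = coeff (UP R) f 0"
proof -
  interpret R: cring R by fact
  interpret UP_cring R "UP R" by (simp add: UP_cring_def assms)
  interpret A: cring_mult_set "UP R" "anderson_set R" by (rule anderson_set_mult[OF assms])
  have one: "coeff (UP R) s 0 = \<one>" if "s \<in> anderson_set R" for s
    using that unfolding anderson_set_def by blast
  have units: "coeff (UP R) s 0 \<in> Units R" if "s \<in> anderson_set R" for s
    unfolding one[OF that] by (rule R.Units_one_closed)
  obtain e where "e \<in> ring_hom (anderson_ring R) R"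
    "\<And>f s. f \<in> carrier (UP R) \<Longrightarrow> s \<in> anderson_set R \<Longrightarrow>
      e (fraction (UP R) (anderson_set R) f s) = coeff (UP R) f 0 \<otimes> inv (coeff (UP R) s 0)"
    using A.localization_lift[OF assms coeff_0_ring_hom units] unfolding anderson_ring_def by blast
  then show thesis using that one by simp
qed

lemma anderson_const_ring_hom:
  assumes "cring R"
  shows "poly_to_anderson R \<circ> const_poly R \<in> ring_hom R (anderson_ring R)"
proof -
  interpret UP_cring R "UP R" by (simp add: UP_cring_def assms)
  interpret A: cring_mult_set "UP R" "anderson_set R" by (rule anderson_set_mult[OF assms])
  show ?thesis
    using ring_hom_trans[OF const_ring_hom A.loc_map_hom]
    by (simp add: anderson_ring_def poly_to_anderson_def const_poly_def[abs_def] comp_def)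
qed

text \<open>The contraction of \<open>base_ext R I\<close> to \<open>R[X]\<close> is an ideal that contains the constants from \<open>I\<close>, so it
  contains \<open>I[X]\<close>. This reduces statements about \<open>IT\<close> to the localization of an explicit ideal of
  \<open>R[X]\<close>.\<close>
lemma base_ext_eq_poly_ext_coeff_ideal:
  assumes "cring R" "ideal I R"
  shows "base_ext R I = poly_ext R (coeff_ideal R I)"
proof -
  interpret R: cring R by fact
  interpret UP_cring R "UP R" by (simp add: UP_cring_def assms)
  interpret A: cring_mult_set "UP R" "anderson_set R" by (rule anderson_set_mult[OF assms(1)])
  interpret T: cring "anderson_ring R" by (rule anderson_ring_cring[OF assms(1)])
  interpret p: ring_hom_ring "UP R" "anderson_ring R" "poly_to_anderson R"
    using A.ring_hom_ring_loc_map by (simp add: anderson_ring_def poly_to_anderson_def)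
  interpret i: ring_hom_ring R "anderson_ring R" "poly_to_anderson R \<circ> const_poly R"
    by (rule ring_hom_ringI2[OF R.ring_axioms T.ring_axioms anderson_const_ring_hom[OF assms(1)]])
  interpret I: ideal I R by fact
  have "I \<subseteq> carrier R" using I.Icarr by auto
  note B = i.ideal_ideal_extension[OF this, folded base_ext_def]
  have "coeff_ideal R I \<subseteq> carrier (UP R)" by (auto simp: coeff_ideal_def)
  note E = p.ideal_ideal_extension[OF this, folded poly_ext_def]
  have const: "const_poly R a \<in> coeff_ideal R I" if "a \<in> I" for a
    using that by (auto simp: const_poly_def coeff_ideal_def I.Icarr)
  have "base_ext R I \<subseteq> poly_ext R (coeff_ideal R I)"
    unfolding base_ext_def by (rule i.ideal_extension_minimal[OF E(1)]) (use const E(2) in auto)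
  moreover have "coeff_ideal R I \<subseteq> {f \<in> carrier (UP R). poly_to_anderson R f \<in> base_ext R I}"
    by (rule coeff_ideal_subset_of_const[OF p.ideal_vimage[OF B(1)]])
      (use B(2) I.Icarr in \<open>auto simp: const_poly_def\<close>)
  then have "poly_ext R (coeff_ideal R I) \<subseteq> base_ext R I"
    unfolding poly_ext_def by (intro p.ideal_extension_minimal[OF B(1)]) auto
  ultimately show ?thesis by blast
qed

lemma primeideal_base_ext:
  assumes "cring R" "primeideal I R"
  shows "primeideal (base_ext R I) (anderson_ring R)"
proof -
  interpret UP_cring R "UP R" by (simp add: UP_cring_def assms)
  interpret A: cring_mult_set "UP R" "anderson_set R" by (rule anderson_set_mult[OF assms(1)])
  interpret I: primeideal I R by fact
  have "\<one>\<^bsub>R\<^esub> \<notin> I" using I.one_imp_carrier I.I_notcarr by auto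
  then have disj: "coeff_ideal R I \<inter> anderson_set R = {}"
    unfolding coeff_ideal_def anderson_set_def disjoint_iff mem_Collect_eq by metis
  show ?thesis
    using A.primeideal_extension_loc_map[OF primeideal_coeff_ideal[OF assms(2)] disj]
    by (simp add: base_ext_eq_poly_ext_coeff_ideal[OF assms(1) I.is_ideal] poly_ext_def
        anderson_ring_def poly_to_anderson_def)
qed

theorem theorem2p1:
  fixes R :: "('a, 'm) ring_scheme" (structure)
  assumes "cring R"
  shows
    "(bij_betw (\<lambda>P. base_ext R P) (min_primes R) (min_primes (anderson_ring R)) \<and>
      (\<forall>Q \<in> min_primes (anderson_ring R). \<exists>P \<in> min_primes R. Q = base_ext R P)) \<and>
     (bij_betw (\<lambda>M. poly_ext R (plus_X_ideal R M)) (max_ideals R) (max_ideals (anderson_ring R)) \<and>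
      max_ideals (anderson_ring R) = {poly_ext R (plus_X_ideal R M) | M. M \<in> max_ideals R})"
proof -
  interpret R: cring R by fact
  interpret UP_cring R "UP R" by (simp add: UP_cring_def assms)
  interpret A: cring_mult_set "UP R" "anderson_set R" by (rule anderson_set_mult[OF assms])
  interpret T: cring "anderson_ring R" by (rule anderson_ring_cring[OF assms])
  interpret i: ring_hom_ring R "anderson_ring R" "poly_to_anderson R \<circ> const_poly R"
    by (rule ring_hom_ringI2[OF R.ring_axioms T.ring_axioms anderson_const_ring_hom[OF assms]])
  let ?frac = "fraction (UP R) (anderson_set R)"
  obtain e where e_hom: "e \<in> ring_hom (anderson_ring R) R"
    and e: "\<And>f s. f \<in> carrier (UP R) \<Longrightarrow> s \<in> anderson_set R \<Longrightarrow> e (?frac f s) = coeff (UP R) f 0"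
    using anderson_constant_term[OF assms] by blast
  interpret e: ring_hom_ring "anderson_ring R" R e
    by (rule ring_hom_ringI2[OF T.ring_axioms R.ring_axioms e_hom])
  have e_i: "e ((poly_to_anderson R \<circ> const_poly R) a) = a" if "a \<in> carrier R" for a
    using that by (simp add: poly_to_anderson_def const_poly_def loc_map_def e)

  have min: "bij_betw (base_ext R) (min_primes R) (min_primes (anderson_ring R))"
    unfolding base_ext_def
  proof (rule i.bij_betw_min_primes_extension[OF assms])
    fix I assume I: "primeideal I R"
    show "primeideal (ideal_extension (anderson_ring R) (poly_to_anderson R \<circ> const_poly R) I)
        (anderson_ring R)"
      using primeideal_base_ext[OF assms I] by (simp add: base_ext_def)
    show "{r \<in> carrier R. (poly_to_anderson R \<circ> const_poly R) r \<in>
        ideal_extension (anderson_ring R) (poly_to_anderson R \<circ> const_poly R) I} = I"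
      by (rule i.contraction_of_extension_of_retract[OF e_hom e_i primeideal.axioms(1)[OF I]])
  qed

  have surj: "e ` carrier (anderson_ring R) = carrier R"
  proof
    show "e ` carrier (anderson_ring R) \<subseteq> carrier R" by auto
    show "carrier R \<subseteq> e ` carrier (anderson_ring R)"
      using e_i i.hom_closed by (metis image_eqI subsetI)
  qed
  have units: "x \<in> Units (anderson_ring R)" if x: "x \<in> carrier (anderson_ring R)" "e x = \<one>" for x
  proof -
    obtain f s where fs: "f \<in> carrier (UP R)" "s \<in> anderson_set R" and xf: "x = ?frac f s"
      using x(1) unfolding anderson_ring_def by (rule A.loc_cases)
    have "coeff (UP R) f 0 = \<one>" using x(2) unfolding xf e[OF fs] .
    then have f: "f \<in> anderson_set R" using fs(1) unfolding anderson_set_def by blast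
    have comm: "s \<otimes>\<^bsub>UP R\<^esub> f = f \<otimes>\<^bsub>UP R\<^esub> s"
      using f fs(2) by (intro P.m_comm A.S_carr)
    have "?frac s f \<otimes>\<^bsub>anderson_ring R\<^esub> x = ?frac (s \<otimes>\<^bsub>UP R\<^esub> f) (f \<otimes>\<^bsub>UP R\<^esub> s)"
      unfolding anderson_ring_def xf by (rule A.loc_mult_fraction) (use f fs in auto)
    also have "\<dots> = \<one>\<^bsub>anderson_ring R\<^esub>"
      unfolding anderson_ring_def A.loc_one comm by (rule A.fraction_eqI1) (use f fs in auto)
    finally have "?frac s f \<otimes>\<^bsub>anderson_ring R\<^esub> x = \<one>\<^bsub>anderson_ring R\<^esub>" .
    moreover have y: "?frac s f \<in> carrier (anderson_ring R)"
      using f fs by (simp add: anderson_ring_def)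
    moreover have "x \<otimes>\<^bsub>anderson_ring R\<^esub> ?frac s f = ?frac s f \<otimes>\<^bsub>anderson_ring R\<^esub> x"
      by (rule T.m_comm[OF x(1) y])
    ultimately show ?thesis using x(1) unfolding Units_def by force
  qed
  have ext: "poly_ext R (plus_X_ideal R M) = {x \<in> carrier (anderson_ring R). e x \<in> M}"
    if "M \<in> max_ideals R" for M
  proof -
    interpret M: maximalideal M R using that by (simp add: max_ideals_def)
    interpret c: ring_hom_ring "UP R" R "\<lambda>f. coeff (UP R) f 0"
      by (rule ring_hom_ringI2[OF P.ring_axioms R.ring_axioms coeff_0_ring_hom])
    have "poly_ext R (plus_X_ideal R M)
        = {?frac f s | f s. (f \<in> carrier (UP R) \<and> coeff (UP R) f 0 \<in> M) \<and> s \<in> anderson_set R}"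
      using A.ideal_extension_loc_map[OF c.ideal_vimage[OF M.is_ideal]]
      by (simp add: plus_X_ideal_eq[OF M.is_ideal] poly_ext_def anderson_ring_def poly_to_anderson_def)
    also have "\<dots> = {x \<in> carrier (anderson_ring R). e x \<in> M}"
    proof (intro equalityI subsetI)
      fix x assume "x \<in> {?frac f s | f s. (f \<in> carrier (UP R) \<and> coeff (UP R) f 0 \<in> M) \<and> s \<in> anderson_set R}"
      then show "x \<in> {x \<in> carrier (anderson_ring R). e x \<in> M}"
        using e by (auto simp: anderson_ring_def)
    next
      fix x assume x: "x \<in> {x \<in> carrier (anderson_ring R). e x \<in> M}"
      then obtain f s where fs: "f \<in> carrier (UP R)" "s \<in> anderson_set R" "x = ?frac f s"
        unfolding anderson_ring_def by (blast elim: A.loc_cases)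
      moreover have "coeff (UP R) f 0 \<in> M" using x e[OF fs(1,2)] fs(3) by simp
      ultimately show "x \<in> {?frac f s | f s. (f \<in> carrier (UP R) \<and> coeff (UP R) f 0 \<in> M) \<and> s \<in> anderson_set R}"
        by blast
    qed
    finally show ?thesis .
  qed
  have max: "bij_betw (\<lambda>M. poly_ext R (plus_X_ideal R M)) (max_ideals R) (max_ideals (anderson_ring R))"
    using e.bij_betw_max_ideals_vimage[OF surj units] by (simp add: ext cong: bij_betw_cong)
  show ?thesis
    using min max bij_betw_imp_surj_on[OF min, symmetric] bij_betw_imp_surj_on[OF max, symmetric]
    by (auto simp: Setcompr_eq_image)
qed

end
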